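(* Let $(B,+,\circ)$ be a finite skew left brace. Then $\mathrm{Pb}(B)=1$, or $\mathrm{Pb}(B)=\frac{3}{4}$, or $\mathrm{Pb}(B)\leqslant\frac{5}{8}$.
   Context: A skew left brace is a set $B$ with two group structures $(B,+)$ and $(B,\circ)$ (neither assumed abelian) such that $a\circ(b+c)=(a\circ b)-a+(a\circ c)$ for all $a,b,c\in B$, where $-a$ is the inverse of $a$ in $(B,+)$. The identities of the two groups coincide and are denoted by $1$. Put $a*b:=-a+(a\circ b)-b$ and $[a,b]^+:=a+b-a-b$. For a finite skew left brace $B$, the commuting probability is $$\mathrm{Pb}(B):=\frac{1}{|B|^2}\,\bigl|\{(a,b)\in B\times B \mid a*b=b*a=[a,b]^+=1\}\bigr|.$$ *)

theory Defs
  imports Complex_Main "HOL-Algebra.Algebra"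
begin

(* The record type of rings only supplies the signature: "add" is the brace addition,
   which need not be commutative, and "mult" is the circle operation. *)
locale skew_left_brace = add: group "add_monoid B" + group B
  for B (structure) +
  assumes brace_distrib:
    "\<lbrakk> a \<in> carrier B; b \<in> carrier B; c \<in> carrier B \<rbrakk>
      \<Longrightarrow> a \<otimes> (b \<oplus> c) = ((a \<otimes> b) \<ominus> a) \<oplus> (a \<otimes> c)"

definition brace_star :: "('a, 'm) ring_scheme \<Rightarrow> 'a \<Rightarrow> 'a \<Rightarrow> 'a" where
  "brace_star B a b = ((\<ominus>\<^bsub>B\<^esub> a) \<oplus>\<^bsub>B\<^esub> (a \<otimes>\<^bsub>B\<^esub> b)) \<ominus>\<^bsub>B\<^esub> b"

definition add_commutator :: "('a, 'm) ring_scheme \<Rightarrow> 'a \<Rightarrow> 'a \<Rightarrow> 'a" where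
  "add_commutator B a b = ((a \<oplus>\<^bsub>B\<^esub> b) \<ominus>\<^bsub>B\<^esub> a) \<ominus>\<^bsub>B\<^esub> b"

(* The two identities coincide (one_eq_zero below), so comparing with the multiplicative
   identity here is the same as comparing with the additive one. *)
definition brace_commuting_pairs :: "('a, 'm) ring_scheme \<Rightarrow> ('a \<times> 'a) set" where
  "brace_commuting_pairs B =
    {(a, b) \<in> carrier B \<times> carrier B.
       brace_star B a b = \<one>\<^bsub>B\<^esub> \<and> brace_star B b a = \<one>\<^bsub>B\<^esub> \<and> add_commutator B a b = \<one>\<^bsub>B\<^esub>}"

definition commuting_probability :: "('a, 'm) ring_scheme \<Rightarrow> real" where
  "commuting_probability B =
    1 / (real (card (carrier B)))\<^sup>2 * real (card (brace_commuting_pairs B))"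

lemma (in skew_left_brace) one_eq_zero: "\<one> = \<zero>"
proof -
  have z: "\<zero> \<in> carrier B" and o: "\<one> \<in> carrier B"
    using add.one_closed by simp_all
  have i: "\<ominus> \<one> \<in> carrier B"
    using add.inv_closed[of \<one>] o by (simp add: a_inv_def)
  have zz: "\<zero> \<oplus> \<zero> = \<zero>" and zi: "\<zero> \<oplus> (\<ominus> \<one>) = \<ominus> \<one>" and iz: "(\<ominus> \<one>) \<oplus> \<zero> = \<ominus> \<one>"
    using add.l_one[of \<zero>] add.l_one[of "\<ominus> \<one>"] add.r_one[of "\<ominus> \<one>"] z i by simp_all
  have "\<zero> = \<ominus> \<one>"
    using brace_distrib[OF o z z] z by (simp add: a_minus_def zz zi iz)
  then have "\<one> \<oplus> \<zero> = \<zero>"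
    using add.r_inv[of \<one>] o by (simp add: a_inv_def)
  then show ?thesis
    using add.r_one[of \<one>] o by simp
qed

end

theory Submission
  imports Defs
begin

text \<open>
  Say that \<open>a\<close> and \<open>b\<close> commute in the brace if the four products \<open>a \<otimes> b\<close>, \<open>b \<otimes> a\<close>, \<open>a \<oplus> b\<close>,
  \<open>b \<oplus> a\<close> are equal; these are the pairs that the commuting probability counts. The
  elements commuting with a given \<open>a\<close> form a subgroup \<open>C a\<close> of the circle group, because the
  brace law controls circle products by an element commuting with \<open>a\<close>
  (\<open>subgroup_brace_commuting\<close>).

  The rest is Lagrange's theorem in the circle group
  (\<open>symmetric_subgroup_relation_density\<close>). Let \<open>Z\<close> be the intersection of
  all the \<open>C a\<close>, of index \<open>k\<close>. By symmetry of commuting, \<open>C a\<close> is everything if \<open>a \<in> Z\<close>, and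
  otherwise it is a proper subgroup, so it has at most half of the elements. Averaging gives
  the bound \<open>1 / k + (1 - 1 / k) / 2\<close>, which is at most \<open>5 / 8\<close> as soon as \<open>k \<ge> 4\<close>.
  For \<open>k = 1\<close> the probability is \<open>1\<close>. If \<open>k\<close> is prime there is no room between \<open>Z\<close> and the
  proper subgroup \<open>C a\<close>, so \<open>C a = Z\<close> for \<open>a \<notin> Z\<close>, and the probability is exactly
  \<open>2 / k - 1 / k\<^sup>2\<close>: this is \<open>3 / 4\<close> for \<open>k = 2\<close> and \<open>5 / 9\<close> for \<open>k = 3\<close>.
\<close>

section \<open>Symmetric relations whose sections are subgroups\<close>

lemma (in group) card_subgroup_dvd_card_subgroup:
  assumes "subgroup H G" "subgroup K G" "H \<subseteq> K"
  shows "card H dvd card K"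
proof -
  have "group (G\<lparr>carrier := K\<rparr>)"
    using assms(2) subgroup.subgroup_is_group is_group by blast
  moreover have "subgroup H (G\<lparr>carrier := K\<rparr>)"
    using assms subgroup_incl by blast
  ultimately show ?thesis
    using group.lagrange[of "G\<lparr>carrier := K\<rparr>" H] by (auto simp: order_def dest: sym)
qed

text \<open>
  The sections of \<open>R\<close> play the role of centralizers. If \<open>R\<close> is the commuting relation of a group,
  the value \<open>3 / 4\<close> cannot occur. It becomes possible because \<open>R\<close> is not assumed reflexive:
  when the intersection of all sections has index two, reflexivity would put an element \<open>a\<close>
  outside the intersection into its own section, which would then be the whole group.
\<close>
lemma (in group) symmetric_subgroup_relation_density:
  fixes R :: "'a \<Rightarrow> 'a \<Rightarrow> bool"
  assumes fin: "finite (carrier G)"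
    and sym: "\<And>a b. a \<in> carrier G \<Longrightarrow> b \<in> carrier G \<Longrightarrow> R a b \<Longrightarrow> R b a"
    and sub: "\<And>a. a \<in> carrier G \<Longrightarrow> subgroup {b \<in> carrier G. R a b} G"
  defines "p \<equiv> real (card {(a, b) \<in> carrier G \<times> carrier G. R a b}) / (real (card (carrier G)))\<^sup>2"
  shows "p = 1 \<or> p = 3 / 4 \<or> p \<le> 5 / 8"
proof -
  define C where "C a = {b \<in> carrier G. R a b}" for a
  define Z where "Z = (\<Inter>a\<in>carrier G. C a)"
  define n where "n = card (carrier G)"
  define z where "z = card Z"
  have C_sub: "subgroup (C a) G" if "a \<in> carrier G" for a
    using sub[OF that] by (simp add: C_def)
  have Z_sub: "subgroup Z G"
    unfolding Z_def by (rule subgroups_Inter) (use C_sub in auto)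
  have Z_carrier: "Z \<subseteq> carrier G"
    using Z_sub subgroup.subset by blast
  have finZ: "finite Z"
    using Z_carrier fin finite_subset by blast
  have "z > 0"
    using finZ subgroup.one_closed[OF Z_sub] by (auto simp: z_def card_gt_0_iff)
  obtain k where k: "n = k * z"
    using card_subgroup_dvd_card_subgroup[OF Z_sub subgroup_self Z_carrier]
    unfolding n_def z_def by (metis dvd_def mult.commute)
  have "n > 0"
    using fin one_closed by (auto simp: n_def card_gt_0_iff)
  then have "k > 0"
    using k by auto
  have C_all: "card (C a) = n" if "a \<in> Z" for a
  proof -
    have "C a = carrier G"
      using that sym Z_carrier unfolding Z_def C_def by auto
    then show ?thesis by (simp add: n_def)
  qed
  have C_proper: "\<exists>m. card (C a) = m * z \<and> m dvd k \<and> m < k" if "a \<in> carrier G - Z" for a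
  proof -
    have a: "a \<in> carrier G" "a \<notin> Z" using that by auto
    have sub_a: "C a \<subseteq> carrier G" by (auto simp: C_def)
    have "Z \<subseteq> C a" using a by (auto simp: Z_def)
    then obtain m where m: "card (C a) = m * z"
      using card_subgroup_dvd_card_subgroup[OF Z_sub C_sub] a
      unfolding z_def by (metis dvd_def mult.commute)
    have "card (C a) dvd n"
      using card_subgroup_dvd_card_subgroup[OF C_sub[OF a(1)] subgroup_self sub_a]
      by (simp add: n_def)
    then have "m dvd k"
      using m k \<open>z > 0\<close> by simp
    have "C a \<noteq> carrier G"
      using a sym unfolding Z_def C_def by auto
    then have "card (C a) < n"
      using sub_a fin unfolding n_def by (simp add: psubset_card_mono psubset_eq)
    then have "m < k"
      using m k \<open>z > 0\<close> by simp
    then show ?thesis using m \<open>m dvd k\<close> by blast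
  qed
  define S where "S = (\<Sum>a\<in>carrier G - Z. card (C a))"
  have "{(a, b) \<in> carrier G \<times> carrier G. R a b} = Sigma (carrier G) C"
    by (auto simp: C_def)
  moreover have "card (Sigma (carrier G) C) = (\<Sum>a\<in>carrier G. card (C a))"
    using fin by (intro card_SigmaI) (auto simp: C_def)
  moreover have "(\<Sum>a\<in>carrier G. card (C a)) = S + (\<Sum>a\<in>Z. card (C a))"
    unfolding S_def by (rule sum.subset_diff[OF Z_carrier fin])
  ultimately have p: "p = real (S + z * n) / (real n)\<^sup>2"
    unfolding p_def n_def[symmetric] by (simp add: C_all z_def)
  have card_outside: "card (carrier G - Z) = n - z"
    using finZ Z_carrier by (simp add: card_Diff_subset n_def z_def)
  have rn: "real n = real k * real z" "real (n - z) = (real k - 1) * real z"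
    using k \<open>k > 0\<close> by (simp_all add: of_nat_diff algebra_simps)
  have p_prime: "p = 2 / real k - 1 / (real k)\<^sup>2" if "Factorial_Ring.prime k"
  proof -
    have "card (C a) = z" if "a \<in> carrier G - Z" for a
      using C_proper[OF that] \<open>Factorial_Ring.prime k\<close> by (auto simp: prime_nat_iff)
    then have "S = (n - z) * z"
      by (simp add: S_def card_outside)
    then have "real (S + z * n) = (real k - 1) * real z * real z + real z * (real k * real z)"
      by (simp only: of_nat_add of_nat_mult rn)
    then have "p = ((real k - 1) * real z * real z + real z * (real k * real z)) / (real k * real z)\<^sup>2"
      using p by (simp only: rn)
    also have "\<dots> = 2 / real k - 1 / (real k)\<^sup>2"
      using \<open>k > 0\<close> \<open>z > 0\<close> by (simp add: field_simps power2_eq_square)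
    finally show ?thesis .
  qed
  consider "k = 1" | "k = 2" | "k = 3" | "k \<ge> 4"
    using \<open>k > 0\<close> by linarith
  then show ?thesis
  proof cases
    case 1
    then have "carrier G - Z = {}"
      using card_outside k fin by (simp add: n_def z_def)
    then have "S = 0"
      unfolding S_def by (simp only: sum.empty)
    then show ?thesis
      using p 1 k \<open>z > 0\<close> by (simp add: power2_eq_square)
  next
    case 2
    then show ?thesis using p_prime by simp
  next
    case 3
    then show ?thesis using p_prime by simp
  next
    case 4
    have "2 * card (C a) \<le> n" if a: "a \<in> carrier G - Z" for a
    proof -
      obtain m where m: "card (C a) = m * z" "m dvd k" "m < k"
        using C_proper[OF a] by blast
      then obtain j where j: "k = m * j" by (auto elim: dvdE)
      with m have "j \<noteq> 0" "j \<noteq> 1" by auto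
      then have "m * 2 \<le> m * j" by (intro mult_le_mono2) linarith
      then show ?thesis using m(1) k j by simp
    qed
    then have "(\<Sum>a\<in>carrier G - Z. 2 * card (C a)) \<le> (n - z) * n"
      using sum_bounded_above[of "carrier G - Z" "\<lambda>a. 2 * card (C a)" n] card_outside by simp
    then have "2 * S \<le> (n - z) * n"
      by (simp add: S_def sum_distrib_left)
    then have "2 * real S \<le> real (n - z) * real n"
      by (metis of_nat_le_iff of_nat_mult of_nat_numeral)
    then have "2 * real (S + z * n) \<le> (real k + 1) * real z * real n"
      by (simp add: rn algebra_simps)
    also have "\<dots> \<le> (5 / 4 * real k) * real z * real n"
      using 4 by (intro mult_right_mono) auto
    also have "\<dots> = 5 / 4 * (real n)\<^sup>2"
      by (simp add: rn power2_eq_square)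
    finally show ?thesis
      using p \<open>n > 0\<close> by (simp add: divide_le_eq)
  qed
qed

section \<open>Commuting pairs in a skew left brace\<close>

definition brace_commute :: "('a, 'm) ring_scheme \<Rightarrow> 'a \<Rightarrow> 'a \<Rightarrow> bool" where
  "brace_commute B a b \<longleftrightarrow>
    a \<otimes>\<^bsub>B\<^esub> b = a \<oplus>\<^bsub>B\<^esub> b \<and> b \<otimes>\<^bsub>B\<^esub> a = a \<oplus>\<^bsub>B\<^esub> b \<and> b \<oplus>\<^bsub>B\<^esub> a = a \<oplus>\<^bsub>B\<^esub> b"

context skew_left_brace
begin

lemmas add_laws =
  add.m_assoc[simplified] add.m_closed[simplified] add.l_one[simplified] add.r_one[simplified]
  add.one_closed[simplified] add.inv_closed[simplified, folded a_inv_def]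
  add.l_inv[simplified, folded a_inv_def] add.r_inv[simplified, folded a_inv_def]

lemma add_minus_cancel [simp]:
  assumes "x \<in> carrier B" "y \<in> carrier B"
  shows "(x \<ominus> y) \<oplus> y = x" "(x \<oplus> y) \<ominus> y = x"
  using assms by (simp_all add: a_minus_def add_laws)

lemma minus_eq_zero_iff:
  assumes "x \<in> carrier B" "y \<in> carrier B"
  shows "x \<ominus> y = \<zero> \<longleftrightarrow> x = y"
  using assms add_minus_cancel(1)[of x y] by (metis a_minus_def add_laws(3,8))

lemma brace_star_eq_one_iff:
  assumes "a \<in> carrier B" "b \<in> carrier B"
  shows "brace_star B a b = \<one> \<longleftrightarrow> a \<otimes> b = a \<oplus> b"
proof -
  have "brace_star B a b = \<one> \<longleftrightarrow> \<ominus> a \<oplus> a \<otimes> b = b"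
    using assms by (simp add: brace_star_def one_eq_zero minus_eq_zero_iff add_laws)
  also have "\<dots> \<longleftrightarrow> a \<oplus> (\<ominus> a \<oplus> a \<otimes> b) = a \<oplus> b"
    using assms add.l_cancel[of a "\<ominus> a \<oplus> a \<otimes> b" b] by (auto simp: add_laws)
  also have "a \<oplus> (\<ominus> a \<oplus> a \<otimes> b) = a \<otimes> b"
    using assms by (simp flip: add.m_assoc[simplified] add: add_laws(2-))
  finally show ?thesis .
qed

lemma add_commutator_eq_one_iff:
  assumes "a \<in> carrier B" "b \<in> carrier B"
  shows "add_commutator B a b = \<one> \<longleftrightarrow> a \<oplus> b = b \<oplus> a"
proof -
  have "add_commutator B a b = \<one> \<longleftrightarrow> a \<oplus> b \<ominus> a = b"
    using assms minus_eq_zero_iff[of "a \<oplus> b \<ominus> a" b]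
    by (simp add: add_commutator_def one_eq_zero add_laws a_minus_def)
  also have "\<dots> \<longleftrightarrow> (a \<oplus> b \<ominus> a) \<oplus> a = b \<oplus> a"
    using assms add.r_cancel[of "a \<oplus> b \<ominus> a" a b] by (auto simp: add_laws(2,6) a_minus_def)
  also have "(a \<oplus> b \<ominus> a) \<oplus> a = a \<oplus> b"
    using assms by (simp add: add_laws(2))
  finally show ?thesis .
qed

lemma brace_commuting_pairs_eq:
  "brace_commuting_pairs B = {(a, b) \<in> carrier B \<times> carrier B. brace_commute B a b}"
  by (auto simp: brace_commuting_pairs_def brace_commute_def
      brace_star_eq_one_iff add_commutator_eq_one_iff)

lemma brace_commute_sym: "brace_commute B a b \<Longrightarrow> brace_commute B b a"
  by (simp add: brace_commute_def)

text \<open>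
  The brace law rewrites \<open>b \<otimes> (a \<oplus> c)\<close> as \<open>a \<oplus> b \<otimes> c\<close> and \<open>b \<otimes> (c \<oplus> a)\<close> as \<open>b \<otimes> c \<oplus> a\<close> if \<open>b\<close>
  commutes with \<open>a\<close>. If \<open>c\<close> commutes with \<open>a\<close> too, then \<open>a \<oplus> c = c \<oplus> a = c \<otimes> a\<close>, so both
  are equal to \<open>b \<otimes> c \<otimes> a\<close>, which gives closure under products.

  For the inverse \<open>i\<close> of \<open>b\<close>, the law is applied to \<open>i \<otimes> (a \<oplus> b)\<close> and \<open>i \<otimes> (b \<oplus> a)\<close>. Both are equal
  to \<open>i \<otimes> (b \<otimes> a) = a\<close>, and since \<open>i \<otimes> b\<close> is also the additive identity, they expand to
  \<open>i \<otimes> a \<ominus> i\<close> and \<open>\<ominus> i \<oplus> i \<otimes> a\<close>. Hence \<open>i \<otimes> a\<close> is both \<open>a \<oplus> i\<close> and \<open>i \<oplus> a\<close>.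
\<close>
lemma subgroup_brace_commuting:
  assumes a: "a \<in> carrier B"
  shows "subgroup {b \<in> carrier B. brace_commute B a b} B"
proof (rule subgroupI)
  show "{b \<in> carrier B. brace_commute B a b} \<subseteq> carrier B" by auto
  have "brace_commute B a \<one>"
    using a by (simp add: brace_commute_def) (simp add: one_eq_zero add_laws)
  then show "{b \<in> carrier B. brace_commute B a b} \<noteq> {}" by auto
next
  fix b assume "b \<in> {b \<in> carrier B. brace_commute B a b}"
  then have b: "b \<in> carrier B" "a \<otimes> b = a \<oplus> b" "b \<otimes> a = a \<oplus> b" "b \<oplus> a = a \<oplus> b"
    by (auto simp: brace_commute_def)
  define i where "i = inv b"
  have i: "i \<in> carrier B" "i \<otimes> b = \<one>" "b \<otimes> i = \<one>"
    using b(1) by (simp_all add: i_def)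
  have cancel: "i \<otimes> (b \<otimes> a) = a"
    using i b(1) a by (simp flip: m_assoc)
  have "a = i \<otimes> (a \<oplus> b)"
    using cancel b(3) by simp
  also have "\<dots> = i \<otimes> a \<ominus> i"
    using brace_distrib[OF i(1) a b(1)] i a by (simp add: one_eq_zero add_laws a_minus_def)
  finally have right: "i \<otimes> a = a \<oplus> i"
    using add_minus_cancel(1)[of "i \<otimes> a" i] i(1) a by simp
  have "a = i \<otimes> (b \<oplus> a)"
    using cancel b(3,4) by simp
  also have "\<dots> = \<ominus> i \<oplus> i \<otimes> a"
    using brace_distrib[OF i(1) b(1) a] i a by (simp add: one_eq_zero add_laws a_minus_def)
  finally have "i \<oplus> a = i \<oplus> (\<ominus> i \<oplus> i \<otimes> a)"
    by simp
  then have left: "i \<otimes> a = i \<oplus> a"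
    using i(1) a by (simp flip: add.m_assoc[simplified] add: add_laws(2-))
  have "a \<otimes> i = i \<otimes> (b \<otimes> a) \<otimes> i"
    by (simp only: cancel)
  also have "\<dots> = i \<otimes> (a \<otimes> b) \<otimes> i"
    by (simp only: b)
  also have "\<dots> = i \<otimes> a"
    using i a b(1) by (simp add: m_assoc)
  finally show "inv b \<in> {b \<in> carrier B. brace_commute B a b}"
    using i(1) left right by (simp add: brace_commute_def i_def)
next
  fix b c
  assume "b \<in> {b \<in> carrier B. brace_commute B a b}" "c \<in> {b \<in> carrier B. brace_commute B a b}"
  then have b: "b \<in> carrier B" "a \<otimes> b = a \<oplus> b" "b \<otimes> a = a \<oplus> b" "b \<oplus> a = a \<oplus> b"
    and c: "c \<in> carrier B" "a \<otimes> c = a \<oplus> c" "c \<otimes> a = a \<oplus> c" "c \<oplus> a = a \<oplus> c"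
    by (auto simp: brace_commute_def)
  have "a \<otimes> (b \<otimes> c) = b \<otimes> a \<otimes> c"
    using a b c by (simp flip: m_assoc)
  also have "\<dots> = b \<otimes> (a \<otimes> c)"
    using a b(1) c(1) by (simp add: m_assoc)
  finally have circ1: "a \<otimes> (b \<otimes> c) = b \<otimes> (a \<oplus> c)"
    using c by simp
  have circ2: "b \<otimes> c \<otimes> a = b \<otimes> (a \<oplus> c)"
    using a b c by (simp add: m_assoc)
  have sum1: "b \<otimes> (a \<oplus> c) = a \<oplus> b \<otimes> c"
    using brace_distrib[OF b(1) a c(1)] a b(1,3) add_minus_cancel(2)[of a b] by simp
  have "b \<otimes> (c \<oplus> a) = (b \<otimes> c \<ominus> b) \<oplus> (b \<oplus> a)"
    using brace_distrib[OF b(1) c(1) a] b(3,4) by simp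
  also have "\<dots> = (b \<otimes> c \<ominus> b \<oplus> b) \<oplus> a"
    using a b(1) c(1) add.m_assoc[of "b \<otimes> c \<ominus> b" b a] by (simp add: add_laws(2,6) a_minus_def)
  also have "\<dots> = b \<otimes> c \<oplus> a"
    using b(1) c(1) by simp
  finally have "b \<otimes> c \<oplus> a = b \<otimes> (a \<oplus> c)"
    using c(4) by simp
  then show "b \<otimes> c \<in> {b \<in> carrier B. brace_commute B a b}"
    using a b(1) c(1) circ1 circ2 sum1 by (simp add: brace_commute_def)
qed

end



theorem theorem3p8:
  fixes B :: "('a, 'm) ring_scheme"
  assumes "skew_left_brace B" and "finite (carrier B)"
  shows "commuting_probability B = 1 \<or> commuting_probability B = 3 / 4 \<or> commuting_probability B \<le> 5 / 8"
proof -
  interpret skew_left_brace B by fact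
  have "commuting_probability B =
    real (card {(a, b) \<in> carrier B \<times> carrier B. brace_commute B a b}) / (real (card (carrier B)))\<^sup>2"
    by (simp add: commuting_probability_def brace_commuting_pairs_eq)
  then show ?thesis
    using symmetric_subgroup_relation_density[of "brace_commute B"]
      assms(2) brace_commute_sym subgroup_brace_commuting by simp
qed

end
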